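(* $\mathrm{ex}_<(n,P_5^{1342})=O(n\log^2 n)$.
   Context: Edge-ordered graph: finite simple graph with a linear order on its edges; isomorphisms preserve order; subgraphs carry induced order; $\mathrm{ex}_<(n,H)$ is the maximum number of edges of an edge-ordered graph on $n$ vertices with no subgraph isomorphic to $H$. Notation: $P_k^{a_1\dots a_{k-1}}$ is the path $v_1\dots v_k$ where edge $v_iv_{i+1}$ has label $a_i$ and edges are ordered by label. *)

theory Defs
  imports Complex_Main "HOL-Library.Landau_Symbols"
begin

record 'a eo_graph =
  verts :: "'a set"
  edges :: "'a set set"
  eord :: "'a set rel"

text \<open>The order is reflexive: \<open>(e, e') \<in> eord G\<close> means that \<open>e\<close> is smaller than or equal to \<open>e'\<close>.\<close>

definition edge_ordered_graph :: "'a eo_graph \<Rightarrow> bool" where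
  "edge_ordered_graph G \<longleftrightarrow>
     finite (verts G) \<and>
     (\<forall>e\<in>edges G. e \<subseteq> verts G \<and> card e = 2) \<and>
     linear_order_on (edges G) (eord G)"

definition eo_subgraph :: "'a eo_graph \<Rightarrow> 'a eo_graph \<Rightarrow> bool" where
  "eo_subgraph K G \<longleftrightarrow>
     edge_ordered_graph K \<and> edge_ordered_graph G \<and>
     verts K \<subseteq> verts G \<and> edges K \<subseteq> edges G \<and>
     eord K = eord G \<inter> edges K \<times> edges K"

definition eo_isomorphism :: "('a \<Rightarrow> 'b) \<Rightarrow> 'a eo_graph \<Rightarrow> 'b eo_graph \<Rightarrow> bool" where
  "eo_isomorphism f G H \<longleftrightarrow>
     bij_betw f (verts G) (verts H) \<and>
     (\<forall>u\<in>verts G. \<forall>v\<in>verts G. {u, v} \<in> edges G \<longleftrightarrow> {f u, f v} \<in> edges H) \<and>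
     (\<forall>e\<in>edges G. \<forall>e'\<in>edges G. (e, e') \<in> eord G \<longleftrightarrow> (f ` e, f ` e') \<in> eord H)"

definition eo_isomorphic :: "'a eo_graph \<Rightarrow> 'b eo_graph \<Rightarrow> bool" where
  "eo_isomorphic G H \<longleftrightarrow> (\<exists>f. eo_isomorphism f G H)"

definition eo_contains :: "'a eo_graph \<Rightarrow> 'b eo_graph \<Rightarrow> bool" where
  "eo_contains G H \<longleftrightarrow> (\<exists>K. eo_subgraph K G \<and> eo_isomorphic K H)"

text \<open>Up to isomorphism, every finite graph has its vertices in \<^typ>\<open>nat\<close>. The maximum is over a
  nonempty set as soon as \<open>H\<close> has an edge (see below).\<close>

definition ex_eo :: "nat \<Rightarrow> 'b eo_graph \<Rightarrow> nat" where
  "ex_eo n H = Max {card (edges G) | G :: nat eo_graph.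
     edge_ordered_graph G \<and> card (verts G) = n \<and> \<not> eo_contains G H}"

text \<open>The path with \<open>length as\<close> edges; its vertices are numbered from 0, so the label of the edge
  \<open>{i, i + 1}\<close> is \<open>as ! i\<close>. The labels are meant to be distinct.\<close>

definition eo_path :: "nat list \<Rightarrow> nat eo_graph" where
  "eo_path as =
     \<lparr>verts = {0..length as},
      edges = {{i, Suc i} | i. i < length as},
      eord = {({i, Suc i}, {j, Suc j}) | i j. i < length as \<and> j < length as \<and> as ! i \<le> as ! j}\<rparr>"

lemma edge_Suc_eq_iff: "{i, Suc i} = {j, Suc j} \<longleftrightarrow> i = j"
  by (auto simp: doubleton_eq_iff)

lemma edge_ordered_graph_eo_path:
  assumes "distinct as"
  shows "edge_ordered_graph (eo_path as)"
proof -
  have inj: "i = j" if "i < length as" "j < length as" "as ! i = as ! j" for i j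
    using that assms by (simp add: nth_eq_iff_index_eq)
  let ?E = "edges (eo_path as)" and ?r = "eord (eo_path as)"
  have mem: "({i, Suc i}, {j, Suc j}) \<in> ?r \<longleftrightarrow>
      i < length as \<and> j < length as \<and> as ! i \<le> as ! j" for i j
    unfolding eo_path_def by (auto simp: edge_Suc_eq_iff)
  have E: "e \<in> ?E \<longleftrightarrow> (\<exists>i<length as. e = {i, Suc i})" for e
    unfolding eo_path_def by auto
  have sub: "?r \<subseteq> ?E \<times> ?E"
    unfolding eo_path_def by auto
  have "refl_on ?E ?r"
    by (rule refl_onI) (auto simp: E mem)
  moreover have "trans ?r"
  proof (rule transI)
    fix x y z assume "(x, y) \<in> ?r" "(y, z) \<in> ?r"
    moreover from this sub have "x \<in> ?E" "y \<in> ?E" "z \<in> ?E" by auto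
    ultimately show "(x, z) \<in> ?r" by (auto simp: E mem)
  qed
  moreover have "antisym ?r"
  proof (rule antisymI)
    fix x y assume "(x, y) \<in> ?r" "(y, x) \<in> ?r"
    moreover from this sub obtain i j where "x = {i, Suc i}" "y = {j, Suc j}"
      by (meson E SigmaD1 SigmaD2 subsetD)
    ultimately show "x = y" using inj[of i j] by (simp add: mem)
  qed
  moreover have "total_on ?E ?r"
    by (rule total_onI) (auto simp: E mem)
  ultimately have "linear_order_on ?E ?r"
    using sub by (simp add: linear_order_on_def partial_order_on_def preorder_on_def)
  moreover have "\<forall>e\<in>?E. e \<subseteq> verts (eo_path as) \<and> card e = 2"
    by (auto simp: eo_path_def)
  ultimately show ?thesis
    by (simp add: edge_ordered_graph_def) (simp add: eo_path_def)
qed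

lemma ex_eo_set_finite_nonempty:
  fixes H :: "'b eo_graph"
  assumes "edge_ordered_graph H" "edges H \<noteq> {}"
  shows "finite {card (edges G) | G :: nat eo_graph.
           edge_ordered_graph G \<and> card (verts G) = n \<and> \<not> eo_contains G H}" (is "finite ?S")
    and "{card (edges G) | G :: nat eo_graph.
           edge_ordered_graph G \<and> card (verts G) = n \<and> \<not> eo_contains G H} \<noteq> {}"
proof -
  have "?S \<subseteq> {..2 ^ n}"
  proof
    fix k assume "k \<in> ?S"
    then obtain G :: "nat eo_graph" where G: "k = card (edges G)" "edge_ordered_graph G"
      "card (verts G) = n" by auto
    then have "edges G \<subseteq> Pow (verts G)" "finite (verts G)"
      by (auto simp: edge_ordered_graph_def)
    then have "card (edges G) \<le> 2 ^ n"
      using card_mono[of "Pow (verts G)" "edges G"] G by (simp add: card_Pow)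
    with G show "k \<in> {..2 ^ n}" by simp
  qed
  then show "finite ?S" by (rule finite_subset) simp
next
  let ?G = "\<lparr>verts = {..<n}, edges = {}, eord = {}\<rparr> :: nat eo_graph"
  have "edge_ordered_graph ?G"
    by (simp add: edge_ordered_graph_def)
  moreover have "\<not> eo_contains ?G H"
  proof
    assume "eo_contains ?G H"
    then obtain K :: "nat eo_graph" and f :: "nat \<Rightarrow> 'b" where K: "edges K = {}" and f: "eo_isomorphism f K H"
      by (auto simp: eo_contains_def eo_isomorphic_def eo_subgraph_def)
    obtain e where e: "e \<in> edges H" using assms by auto
    then have "e \<subseteq> verts H" "card e = 2"
      using assms by (auto simp: edge_ordered_graph_def)
    then obtain x y where xy: "e = {x, y}" "x \<in> verts H" "y \<in> verts H"
      by (auto simp: card_2_iff)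
    then obtain u v where "u \<in> verts K" "v \<in> verts K" "x = f u" "y = f v"
      using f unfolding eo_isomorphism_def bij_betw_def by (metis imageE)
    then show False using e xy f K by (auto simp: eo_isomorphism_def)
  qed
  ultimately show "{card (edges G) | G :: nat eo_graph.
      edge_ordered_graph G \<and> card (verts G) = n \<and> \<not> eo_contains G H} \<noteq> {}"
    by (auto intro!: exI[of _ ?G])
qed

end

theory Submission
  imports Defs
begin

text \<open>Label the edges by integers below \<open>2 ^ k\<close>. If \<open>v\<close> has neighbours \<open>a\<close>, \<open>c\<close> with
  \<open>va < vc\<close>, then in the absence of the path every edge at \<open>c\<close> below \<open>va\<close> is (up to degeneracies)
  below almost all edges at \<open>a\<close>. So if the gaps just below \<open>va\<close> in the labels at \<open>a\<close> and just below
  \<open>vc\<close> in the labels at \<open>c\<close> contain a common label, then the gap at \<open>c\<close> swallows all small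
  labels at \<open>a\<close>, and is twice as long as the gap at \<open>a\<close> except for \<open>O(k)\<close> exceptional edges at
  \<open>a\<close>. Hence, for each \<open>v\<close>, a fixed label lies in only \<open>O(k)\<close> of these gaps.

  Every edge \<open>vw\<close> has an end, say \<open>v\<close>, such that the gap at \<open>w\<close> contains an edge at
  \<open>v\<close>. If \<open>vy\<close> is the first such edge, then the gap below \<open>vy\<close> in the labels at \<open>v\<close> contains the small
  labels at \<open>y\<close>. By the previous paragraph, each \<open>y\<close> has \<open>O(k)\<close> such edges \<open>vy\<close>, and
  each of them comes from \<open>O(k)\<close> edges \<open>vw\<close>. This gives \<open>O(n k\<^sup>2)\<close> edges.\<close>

section \<open>Counting by dyadic scales and by ranks\<close>

lemma card_le_2_if_no_three:
  fixes key :: "'a \<Rightarrow> nat"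
  assumes "finite T" "inj_on key T"
    and no: "\<And>s u t. \<lbrakk>s \<in> T; u \<in> T; t \<in> T; key s < key u; key u < key t\<rbrakk> \<Longrightarrow> False"
  shows "card T \<le> 2"
proof (rule ccontr)
  assume "\<not> card T \<le> 2"
  then obtain S where S: "S \<subseteq> T" "card S = 3"
    using obtain_subset_with_card_n[of 3 T] by auto
  then obtain a b c where abc: "S = {a, b, c}" "a \<noteq> b" "b \<noteq> c" "a \<noteq> c"
    by (auto simp: card_3_iff)
  then have T: "a \<in> T" "b \<in> T" "c \<in> T" using S by auto
  then have "key a \<noteq> key b" "key b \<noteq> key c" "key a \<noteq> key c"
    using abc assms(2) by (auto dest: inj_onD)
  then show False
    using no T by (metis linorder_neqE_nat)
qed

text \<open>Each dyadic range of \<open>D\<close> holds at most two elements: of three, the one with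
  the largest key would have at least twice the \<open>D\<close> of another and so leave the range.
  Doubling is asked against only one of two earlier elements because the other may be
  degenerate.\<close>

lemma card_le_if_doubling:
  fixes key D :: "'a \<Rightarrow> nat"
  assumes "finite T" "inj_on key T"
    and "\<And>t. t \<in> T \<Longrightarrow> 1 \<le> D t" "\<And>t. t \<in> T \<Longrightarrow> D t < 2 ^ k"
    and "\<And>s u t. \<lbrakk>s \<in> T; u \<in> T; t \<in> T; key s < key u; key u < key t\<rbrakk>
           \<Longrightarrow> 2 * D s \<le> D t \<or> 2 * D u \<le> D t"
  shows "card T \<le> 2 * k"
  using assms
proof (induction k arbitrary: T)
  case 0
  then have "T = {}" by fastforce
  then show ?case by simp
next
  case (Suc k)
  let ?A = "{t \<in> T. D t < 2 ^ k}" and ?B = "{t \<in> T. 2 ^ k \<le> D t}"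
  have inj: "inj_on key ?A" "inj_on key ?B"
    using Suc.prems(2) by (auto simp: inj_on_def)
  have "card ?A \<le> 2 * k"
    by (rule Suc.IH) (use Suc.prems inj in auto)
  moreover have "card ?B \<le> 2"
  proof (rule card_le_2_if_no_three[OF _ inj(2)])
    fix s u t assume "s \<in> ?B" "u \<in> ?B" "t \<in> ?B" "key s < key u" "key u < key t"
    then show False
      using Suc.prems(4)[of t] Suc.prems(5)[of s u t] by auto
  qed (use Suc.prems in auto)
  moreover have "T = ?A \<union> ?B" by auto
  then have "card T \<le> card ?A + card ?B" by (metis card_Un_le)
  ultimately show ?case by simp
qed

lemma obtain_four_less:
  fixes B :: "nat set"
  assumes "4 \<le> card B"
  obtains l1 l2 l3 l4 where "l1 \<in> B" "l2 \<in> B" "l3 \<in> B" "l4 \<in> B" "l1 < l2" "l2 < l3" "l3 < l4"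
proof -
  let ?xs = "sorted_list_of_set B"
  have fin: "finite B" using assms by (metis card.infinite not_numeral_le_zero)
  then have len: "length ?xs \<ge> 4" and set: "set ?xs = B"
    using assms by auto
  have "?xs ! i \<in> B" if "i < 4" for i
    using that len set nth_mem[of i ?xs] by auto
  moreover have "?xs ! i < ?xs ! j" if "i < j" "j < 4" for i j
    using that len by (intro sorted_wrt_nth_less[OF strict_sorted_list_of_set]) auto
  ultimately show thesis
    using that[of "?xs ! 0" "?xs ! 1" "?xs ! 2" "?xs ! 3"] by simp
qed

lemma card_low_rank_le:
  fixes key :: "'a \<Rightarrow> nat"
  assumes "finite T" "inj_on key T"
  shows "card {t \<in> T. card {l \<in> key ` T. l < key t} < r} \<le> r"
proof -
  let ?rank = "\<lambda>t. card {l \<in> key ` T. l < key t}"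
  have less: "?rank s < ?rank t" if "s \<in> T" "t \<in> T" "key s < key t" for s t
    by (rule psubset_card_mono) (use assms that in auto)
  have "inj_on ?rank T"
  proof (rule inj_onI)
    fix s t assume "s \<in> T" "t \<in> T" "?rank s = ?rank t"
    then have "key s = key t"
      using less[of s t] less[of t s] by (metis less_irrefl linorder_neqE_nat)
    then show "s = t" using \<open>s \<in> T\<close> \<open>t \<in> T\<close> assms(2) by (auto dest: inj_onD)
  qed
  then have "card {t \<in> T. ?rank t < r} = card (?rank ` {t \<in> T. ?rank t < r})"
    by (intro card_image[symmetric]) (auto simp: inj_on_def)
  also have "\<dots> \<le> card {..<r}" by (rule card_mono) auto
  finally show ?thesis by simp
qed

lemma card_Sigma_le:
  assumes "finite V" "\<And>x. x \<in> V \<Longrightarrow> finite (F x) \<and> card (F x) \<le> c"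
  shows "card (SIGMA x:V. F x) \<le> card V * c"
proof -
  have "card (SIGMA x:V. F x) = (\<Sum>x\<in>V. card (F x))"
    using assms by (intro card_SigmaI) auto
  also have "\<dots> \<le> card V * c"
    using assms sum_bounded_above[of V "\<lambda>x. card (F x)" c] by auto
  finally show ?thesis .
qed

section \<open>Labelled graphs and the gaps below their labels\<close>

locale labelled_P1342_free =
  fixes V :: "'a set" and adj :: "'a \<Rightarrow> 'a \<Rightarrow> bool" and lab :: "'a \<Rightarrow> 'a \<Rightarrow> nat" and k :: nat
  assumes finite_V: "finite V"
    and adj_V: "adj x y \<Longrightarrow> x \<in> V"
    and adj_sym: "adj x y \<Longrightarrow> adj y x"
    and adj_irrefl: "\<not> adj x x"
    and lab_sym: "lab x y = lab y x"
    and lab_inj: "adj x y \<Longrightarrow> adj u v \<Longrightarrow> lab x y = lab u v \<Longrightarrow> {x, y} = {u, v}"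
    and lab_less: "adj x y \<Longrightarrow> lab x y < 2 ^ k"
    and path_free: "\<lbrakk>adj a b; adj b c; adj c d; adj d e;
      lab a b < lab d e; lab d e < lab b c; lab b c < lab c d\<rbrakk> \<Longrightarrow> \<not> distinct [a, b, c, d, e]"
begin

definition nbrs :: "'a \<Rightarrow> 'a set" where
  "nbrs x = {y. adj x y}"

definition labs :: "'a \<Rightarrow> nat set" where
  "labs x = lab x ` nbrs x"

text \<open>The third smallest label at \<open>x\<close>, when there is one. Three edges at
  \<open>x\<close> are what it takes for one of them to avoid two prescribed vertices.\<close>

definition third :: "'a \<Rightarrow> nat" where
  "third x = Min {l \<in> labs x. \<exists>l1\<in>labs x. \<exists>l2\<in>labs x. l1 < l2 \<and> l2 < l}"

text \<open>The second largest label at \<open>x\<close> below \<open>b\<close>. The largest one would not do: the corresponding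
  edge may close a triangle instead of extending a path.\<close>

definition pred2 :: "'a \<Rightarrow> nat \<Rightarrow> nat" where
  "pred2 x b = Max {l \<in> labs x. \<exists>l'\<in>labs x. l < l' \<and> l' < b}"

text \<open>Among four labels below \<open>b\<close>, the second largest is at least the third
  smallest. So outside \<open>low\<close> both \<open>third x\<close> and \<open>pred2 x b\<close>
  are proper values, and the subtractions in \<open>jump\<close> are not truncated.\<close>

definition low :: "'a \<Rightarrow> nat \<Rightarrow> bool" where
  "low x b \<longleftrightarrow> card {l \<in> labs x. l < b} < 4"

definition jump :: "'a \<Rightarrow> nat \<Rightarrow> bool" where
  "jump x b \<longleftrightarrow> pred2 x b - third x < b - pred2 x b"

definition good :: "'a \<Rightarrow> nat \<Rightarrow> bool" where
  "good x b \<longleftrightarrow> \<not> low x b \<and> \<not> jump x b"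

lemma nbrs_subset: "nbrs x \<subseteq> V"
  using adj_V adj_sym by (auto simp: nbrs_def)

lemma finite_nbrs: "finite (nbrs x)"
  using nbrs_subset finite_V by (rule finite_subset)

lemma finite_labs: "finite (labs x)"
  by (simp add: labs_def finite_nbrs)

lemma inj_on_lab: "inj_on (lab x) (nbrs x)"
  by (rule inj_onI) (use lab_inj in \<open>fastforce simp: nbrs_def doubleton_eq_iff\<close>)

text \<open>The two edges labelled \<open>l\<close> coincide by injectivity, so this edge contains
  both \<open>v\<close> and \<open>w\<close>. This tells apart the lower ends of the gaps at the two
  ends of an edge.\<close>

lemma labs_common:
  assumes "adj v w" "l \<in> labs v" "l \<in> labs w"
  shows "l = lab v w"
proof -
  obtain y z where yz: "adj v y" "adj w z" "l = lab v y" "l = lab w z"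
    using assms by (auto simp: labs_def nbrs_def)
  then have "{v, y} = {w, z}" by (intro lab_inj) auto
  moreover have "v \<noteq> w" using assms adj_irrefl by auto
  ultimately have "y = w" by (auto simp: doubleton_eq_iff)
  then show ?thesis using yz by simp
qed

lemma lab_in_labs: "adj x y \<Longrightarrow> lab x y \<in> labs x"
  by (auto simp: labs_def nbrs_def)

lemma third_props:
  assumes "l1 \<in> labs x" "l2 \<in> labs x" "l3 \<in> labs x" "l1 < l2" "l2 < l3"
  shows third_le: "third x \<le> l3"
    and "third x \<in> labs x"
    and "\<exists>l1\<in>labs x. \<exists>l2\<in>labs x. l1 < l2 \<and> l2 < third x"
proof -
  let ?S = "{l \<in> labs x. \<exists>l1\<in>labs x. \<exists>l2\<in>labs x. l1 < l2 \<and> l2 < l}"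
  have S: "finite ?S" "l3 \<in> ?S" using finite_labs assms by auto
  then show "third x \<le> l3" unfolding third_def by (rule Min_le)
  have "third x \<in> ?S" unfolding third_def by (rule Min_in) (use S in auto)
  then show "third x \<in> labs x" "\<exists>l1\<in>labs x. \<exists>l2\<in>labs x. l1 < l2 \<and> l2 < third x" by auto
qed

lemma pred2_props:
  assumes "l \<in> labs x" "l' \<in> labs x" "l < l'" "l' < b"
  shows pred2_ge: "l \<le> pred2 x b"
    and "pred2 x b \<in> labs x"
    and "\<exists>l'\<in>labs x. pred2 x b < l' \<and> l' < b"
proof -
  let ?S = "{l \<in> labs x. \<exists>l'\<in>labs x. l < l' \<and> l' < b}"
  have S: "finite ?S" "l \<in> ?S" using finite_labs assms by auto
  then show "l \<le> pred2 x b" unfolding pred2_def by (rule Max_ge)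
  have "pred2 x b \<in> ?S" unfolding pred2_def by (rule Max_in) (use S in auto)
  then show "pred2 x b \<in> labs x" "\<exists>l'\<in>labs x. pred2 x b < l' \<and> l' < b" by auto
qed

lemma not_low:
  assumes "\<not> low x b"
  shows "third x \<le> pred2 x b" "pred2 x b < b" "pred2 x b \<in> labs x" "third x \<in> labs x"
    and "\<exists>l'\<in>labs x. pred2 x b < l' \<and> l' < b"
    and "\<exists>l1\<in>labs x. \<exists>l2\<in>labs x. l1 < l2 \<and> l2 < third x"
proof -
  have "4 \<le> card {l \<in> labs x. l < b}" using assms by (simp add: low_def)
  then obtain l1 l2 l3 l4 where "l1 \<in> {l \<in> labs x. l < b}" "l2 \<in> {l \<in> labs x. l < b}"
    "l3 \<in> {l \<in> labs x. l < b}" "l4 \<in> {l \<in> labs x. l < b}" and lt: "l1 < l2" "l2 < l3" "l3 < l4"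
    by (rule obtain_four_less)
  then have l: "l1 \<in> labs x" "l2 \<in> labs x" "l3 \<in> labs x" "l4 \<in> labs x" "l4 < b" by auto
  note t = third_props[OF l(1,2,3) lt(1,2)] and p = pred2_props[OF l(3,4) lt(3) l(5)]
  show "third x \<le> pred2 x b" using t(1) p(1) by simp
  show "pred2 x b < b" using p(3) by auto
  show "pred2 x b \<in> labs x" "third x \<in> labs x" using p t by auto
  show "\<exists>l'\<in>labs x. pred2 x b < l' \<and> l' < b" by (rule p(3))
  show "\<exists>l1\<in>labs x. \<exists>l2\<in>labs x. l1 < l2 \<and> l2 < third x" by (rule t(3))
qed

text \<open>Otherwise one of the three smallest edges at \<open>a\<close>, ending in
  \<open>y\<close>, avoids \<open>c\<close> and \<open>z\<close>, and the path
  \<open>y, a, v, c, z\<close> has its labels in the order 1342.\<close>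

lemma le_third:
  assumes "\<not> low a b0" "adj v a" "adj v c" "adj c z" "z \<noteq> a"
    and "lab v a < lab v c" "lab c z < lab v a"
  shows "lab c z \<le> third a"
proof (rule ccontr)
  assume "\<not> lab c z \<le> third a"
  then have lt: "third a < lab c z" by simp
  obtain l1 l2 where l: "l1 \<in> labs a" "l2 \<in> labs a" "l1 < l2" "l2 < third a"
    using not_low(6)[OF assms(1)] by blast
  have l3: "third a \<in> labs a" by (rule not_low(4)[OF assms(1)])
  obtain y1 y2 y3 where y: "adj a y1" "adj a y2" "adj a y3"
    "lab a y1 = l1" "lab a y2 = l2" "lab a y3 = third a"
    using l l3 by (auto simp: labs_def nbrs_def)
  have "y1 \<noteq> y2" "y2 \<noteq> y3" "y1 \<noteq> y3" using y l by auto
  then obtain y where y': "adj a y" "lab a y \<le> third a" "y \<noteq> c" "y \<noteq> z"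
    using y l by (metis less_imp_le order.refl order.strict_trans)
  \<comment> \<open>Labels rule out the other coincidences: \<open>lab a y < lab v a\<close> and
    \<open>lab c z < lab v c\<close>, so neither \<open>y\<close> nor \<open>z\<close> is
    \<open>v\<close>.\<close>
  have "y \<noteq> v" using y' lt assms(7) lab_sym[of a v] by auto
  moreover have "a \<noteq> c" using assms by auto
  moreover have "z \<noteq> v" using assms lab_sym[of c v] by auto
  moreover have "y \<noteq> a" "a \<noteq> v" "v \<noteq> c" "c \<noteq> z" using y' assms adj_irrefl by auto
  ultimately have "distinct [y, a, v, c, z]" using y' assms(5) by auto
  moreover have "\<not> distinct [y, a, v, c, z]"
    using path_free[of y a v c z] y' assms lt adj_sym lab_sym by (metis order.strict_trans1)
  ultimately show False by simp
qed

text \<open>At a jump the distance of the label from \<open>third x\<close> is more than twice that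
  of \<open>pred2\<close>. Of two earlier neighbours, the first has its label at or below this
  \<open>pred2\<close>, because the second lies in between.\<close>

lemma card_jump_le: "card {w \<in> nbrs x. \<not> low x (lab x w) \<and> jump x (lab x w)} \<le> 2 * k"
    (is "card ?T \<le> _")
proof (rule card_le_if_doubling[where key = "lab x" and D = "\<lambda>w. lab x w - third x"])
  show "finite ?T" using finite_nbrs by auto
  show "inj_on (lab x) ?T" using inj_on_lab by (rule inj_on_subset) auto
  fix t assume t: "t \<in> ?T"
  then show "1 \<le> lab x t - third x" using not_low(1,2)[of x "lab x t"] by auto
  show "lab x t - third x < 2 ^ k" using t lab_less[of x t] by (auto simp: nbrs_def)
next
  fix s u t assume stu: "s \<in> ?T" "u \<in> ?T" "t \<in> ?T" "lab x s < lab x u" "lab x u < lab x t"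
  then have "lab x s \<le> pred2 x (lab x t)"
    by (intro pred2_ge[of _ _ "lab x u"]) (auto simp: nbrs_def lab_in_labs)
  then have "2 * (lab x s - third x) \<le> lab x t - third x"
    using stu not_low(1,2)[of x "lab x t"] by (auto simp: jump_def)
  then show "2 * (lab x s - third x) \<le> lab x t - third x
      \<or> 2 * (lab x u - third x) \<le> lab x t - third x" ..
qed

lemma card_not_good_le: "card {w \<in> nbrs x. \<not> good x (lab x w)} \<le> 4 + 2 * k"
proof -
  have "{w \<in> nbrs x. \<not> good x (lab x w)} =
      {w \<in> nbrs x. low x (lab x w)} \<union> {w \<in> nbrs x. \<not> low x (lab x w) \<and> jump x (lab x w)}"
    by (auto simp: good_def)
  then have "card {w \<in> nbrs x. \<not> good x (lab x w)} \<le> card {w \<in> nbrs x. low x (lab x w)} +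
      card {w \<in> nbrs x. \<not> low x (lab x w) \<and> jump x (lab x w)}"
    by (simp only: card_Un_le)
  moreover have "card {w \<in> nbrs x. low x (lab x w)} \<le> 4"
    unfolding low_def labs_def using card_low_rank_le[OF finite_nbrs inj_on_lab] .
  ultimately show ?thesis using card_jump_le[of x] by linarith
qed

text \<open>The gaps \<open>{pred2 w (lab v w)..lab v w}\<close> all contain \<open>t\<close>. Hence the edge at the lower end of
  a later gap cannot lie above \<open>third w\<close> for an earlier \<open>w\<close>, and the later gap is at least twice as
  long as the earlier one because there is no jump at \<open>w\<close>.\<close>

lemma card_stabbed_le:
  "card {w \<in> nbrs v. good w (lab v w) \<and> pred2 w (lab v w) \<le> t \<and> t < lab v w} \<le> 2 * k"
    (is "card ?T \<le> _")
proof (rule card_le_if_doubling[where key = "lab v" and D = "\<lambda>w. lab v w - pred2 w (lab v w)"])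
  show "finite ?T" using finite_nbrs by auto
  show "inj_on (lab v) ?T" using inj_on_lab by (rule inj_on_subset) auto
  fix w assume w: "w \<in> ?T"
  then show "1 \<le> lab v w - pred2 w (lab v w)" by auto
  show "lab v w - pred2 w (lab v w) < 2 ^ k" using w lab_less[of v w] by (auto simp: nbrs_def)
next
  let ?D = "\<lambda>w. lab v w - pred2 w (lab v w)"
  have doubling: "2 * ?D a \<le> ?D c"
    if "a \<in> ?T" "c \<in> ?T" "lab v a < lab v c" "adj c z" "pred2 c (lab v c) = lab c z" "z \<noteq> a" for a c z
  proof -
    \<comment> \<open>The common point gives \<open>lab c z \<le> t < lab v a\<close>, as
      \<open>le_third\<close> requires.\<close>
    have "lab c z \<le> third a"
      by (rule le_third[of a "lab v a" v]) (use that in \<open>auto simp: good_def nbrs_def\<close>)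
    then show ?thesis
      using that not_low(1,2)[of a "lab v a"] by (auto simp: good_def jump_def)
  qed
  fix a b c assume abc: "a \<in> ?T" "b \<in> ?T" "c \<in> ?T" "lab v a < lab v b" "lab v b < lab v c"
  then have "pred2 c (lab v c) \<in> labs c"
    using not_low(3)[of c "lab v c"] by (auto simp: good_def)
  then obtain z where z: "adj c z" "pred2 c (lab v c) = lab c z"
    by (auto simp: labs_def nbrs_def)
  \<comment> \<open>The edge at the lower end of the gap at \<open>c\<close> can close a triangle
    with one of \<open>a\<close>, \<open>b\<close>, but not with both.\<close>
  have "a \<noteq> b" using abc by auto
  then have "z \<noteq> a \<or> z \<noteq> b" by auto
  then show "2 * ?D a \<le> ?D c \<or> 2 * ?D b \<le> ?D c"
    using doubling[OF abc(1,3) _ z] doubling[OF abc(2,3) _ z] abc by auto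
qed

section \<open>Anchors and the edge count\<close>

definition arcs :: "('a \<times> 'a) set" where
  "arcs = (SIGMA v:V. nbrs v)"

definition bad_arcs :: "('a \<times> 'a) set" where
  "bad_arcs = {(v, w) \<in> arcs. \<not> good v (lab v w) \<or> \<not> good w (lab v w)}"

definition anchor_arcs :: "('a \<times> 'a) set" where
  "anchor_arcs = bad_arcs \<union> {(v, y) \<in> arcs - bad_arcs. pred2 v (lab v y) \<le> third y}"

lemma arcs_iff: "(v, w) \<in> arcs \<longleftrightarrow> adj v w"
  using adj_V by (auto simp: arcs_def nbrs_def)

lemma finite_arcs: "finite arcs"
  by (auto simp: arcs_def finite_V finite_nbrs)

lemma card_bad_arcs_le: "card bad_arcs \<le> 2 * (card V * (4 + 2 * k))"
proof -
  let ?S = "SIGMA v:V. {w \<in> nbrs v. \<not> good v (lab v w)}"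
  have S: "card ?S \<le> card V * (4 + 2 * k)"
    by (rule card_Sigma_le) (use finite_V finite_nbrs card_not_good_le in auto)
  have fin: "finite ?S" using finite_V finite_nbrs by auto
  \<comment> \<open>The swapped copy accounts for arcs that are bad at their second end.\<close>
  have "bad_arcs \<subseteq> ?S \<union> prod.swap ` ?S"
  proof
    fix p assume "p \<in> bad_arcs"
    then obtain v w where p: "p = (v, w)" "adj v w" "\<not> good v (lab v w) \<or> \<not> good w (lab v w)"
      by (auto simp: bad_arcs_def arcs_iff)
    then show "p \<in> ?S \<union> prod.swap ` ?S"
      using adj_V adj_sym[of v w] lab_sym[of v w] by (force simp: nbrs_def)
  qed
  then have "card bad_arcs \<le> card (?S \<union> prod.swap ` ?S)"
    by (rule card_mono[rotated]) (use fin in auto)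
  also have "\<dots> \<le> card ?S + card (prod.swap ` ?S)" by (rule card_Un_le)
  also have "card (prod.swap ` ?S) \<le> card ?S" using fin by (rule card_image_le)
  finally show ?thesis using S by linarith
qed

text \<open>For fixed \<open>y\<close>, the gaps at the neighbours \<open>v\<close> are all stabbed
  by \<open>third y\<close>, so \<open>card_stabbed_le\<close> applies at \<open>y\<close>.\<close>

lemma card_anchor_arcs_le: "card anchor_arcs \<le> 2 * (card V * (4 + 2 * k)) + card V * (2 * k)"
proof -
  let ?S = "SIGMA y:V. {v \<in> nbrs y. good v (lab y v) \<and> pred2 v (lab y v) \<le> third y \<and> third y < lab y v}"
  have fin: "finite ?S" using finite_V finite_nbrs by auto
  have "{(v, y) \<in> arcs - bad_arcs. pred2 v (lab v y) \<le> third y} \<subseteq> prod.swap ` ?S"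
  proof
    fix p assume "p \<in> {(v, y) \<in> arcs - bad_arcs. pred2 v (lab v y) \<le> third y}"
    then obtain v y where p: "p = (v, y)" "adj v y" "good v (lab v y)" "good y (lab v y)"
      "pred2 v (lab v y) \<le> third y"
      by (auto simp: bad_arcs_def arcs_iff)
    then have "third y < lab v y" using not_low(1,2)[of y "lab v y"] by (auto simp: good_def)
    then have "(y, v) \<in> ?S"
      using p adj_V adj_sym[of v y] lab_sym[of v y] by (auto simp: nbrs_def)
    then show "p \<in> prod.swap ` ?S" using p by force
  qed
  then have "card {(v, y) \<in> arcs - bad_arcs. pred2 v (lab v y) \<le> third y} \<le> card (prod.swap ` ?S)"
    by (rule card_mono[rotated]) (use fin in auto)
  also have "\<dots> \<le> card ?S" using fin by (rule card_image_le)
  also have "\<dots> \<le> card V * (2 * k)"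
    by (rule card_Sigma_le) (use finite_V finite_nbrs card_stabbed_le in auto)
  finally show ?thesis
    unfolding anchor_arcs_def
    using card_bad_arcs_le card_Un_le[of bad_arcs "{(v, y) \<in> arcs - bad_arcs. pred2 v (lab v y) \<le> third y}"]
    by linarith
qed

text \<open>The anchor is the first or the second edge at \<open>v\<close> above \<open>pred2 w (lab v w)\<close>, whichever does not
  close a triangle with the edge at \<open>w\<close> carrying that label.\<close>

lemma anchor_exists:
  assumes "adj v w" "good v (lab v w)" "good w (lab v w)"
    and type: "pred2 w (lab v w) < pred2 v (lab v w)"
  shows "\<exists>y. (v, y) \<in> anchor_arcs \<and> pred2 w (lab v w) \<le> lab v y \<and> lab v y < lab v w"
proof -
  define q where "q = pred2 w (lab v w)"
  have lowv: "\<not> low v (lab v w)" and loww: "\<not> low w (lab v w)"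
    using assms by (auto simp: good_def)
  obtain z where z: "adj w z" "q = lab w z"
    using not_low(3)[OF loww] by (auto simp: q_def labs_def nbrs_def)
  define h1 where "h1 = Min {l \<in> labs v. q < l}"
  have "h1 \<in> {l \<in> labs v. q < l}"
    unfolding h1_def by (rule Min_in) (use not_low(3)[OF lowv] type finite_labs in \<open>auto simp: q_def\<close>)
  then have h1: "h1 \<in> labs v" "q < h1" by auto
  have h1_le: "h1 \<le> l" if "l \<in> labs v" "q < l" for l
    unfolding h1_def by (rule Min_le) (use that finite_labs in auto)
  obtain l' where l': "l' \<in> labs v" "pred2 v (lab v w) < l'" "l' < lab v w"
    using not_low(5)[OF lowv] by blast
  \<comment> \<open>Both \<open>pred2 v (lab v w)\<close> and \<open>l'\<close> lie between
    \<open>q\<close> and \<open>lab v w\<close>, which leaves room for \<open>h1\<close> and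
    \<open>h2\<close> there.\<close>
  have "h1 < l'" using h1_le[of "pred2 v (lab v w)"] not_low(3)[OF lowv] type l' by (auto simp: q_def)
  define h2 where "h2 = Min {l \<in> labs v. h1 < l}"
  have "h2 \<in> {l \<in> labs v. h1 < l}"
    unfolding h2_def by (rule Min_in) (use \<open>h1 < l'\<close> l' finite_labs in auto)
  then have h2: "h2 \<in> labs v" "h1 < h2" by auto
  have h2_le: "h2 \<le> l" if "l \<in> labs v" "h1 < l" for l
    unfolding h2_def by (rule Min_le) (use that finite_labs in auto)
  have h2_less: "h2 < lab v w" using h2_le[of l'] l' \<open>h1 < l'\<close> by auto
  obtain y1 y2 where y: "adj v y1" "h1 = lab v y1" "adj v y2" "h2 = lab v y2"
    using h1 h2 by (auto simp: labs_def nbrs_def)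
  then have "y1 \<noteq> y2" using h2 by auto
  then obtain y where y': "adj v y" "z \<noteq> y" "lab v y = h1 \<or> lab v y = h2"
    using y by metis
  then have between: "q < lab v y" "lab v y < lab v w" using h1 h2 h2_less by auto
  have "(v, y) \<in> anchor_arcs"
  proof (cases "(v, y) \<in> bad_arcs")
    case False
    then have g: "\<not> low v (lab v y)" "\<not> low y (lab v y)"
      using y' by (auto simp: bad_arcs_def arcs_iff good_def)
    \<comment> \<open>Here \<open>y\<close> and \<open>w\<close> are the two neighbours of
      \<open>v\<close> in \<open>le_third\<close>, and the choice \<open>z \<noteq> y\<close> is
      what it needs.\<close>
    have "q \<le> third y"
      unfolding z(2) using le_third[OF g(2) y'(1) assms(1) z(1)] y' between z by auto
    \<comment> \<open>Only \<open>h1\<close> can be a label at \<open>v\<close> strictly between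
      \<open>q\<close> and \<open>lab v y\<close>, so the second largest label below
      \<open>lab v y\<close> is not above \<open>q\<close>.\<close>
    moreover have "pred2 v (lab v y) \<le> q"
    proof -
      obtain m where m: "m \<in> labs v" "pred2 v (lab v y) < m" "m < lab v y"
        using not_low(5)[OF g(1)] by blast
      then have "m < h2" using y'(3) h2 by auto
      then have "m \<le> h1" using h2_le[of m] m by linarith
      then have "pred2 v (lab v y) < h1" using m by auto
      then show ?thesis using h1_le[of "pred2 v (lab v y)"] not_low(3)[OF g(1)] by linarith
    qed
    ultimately show ?thesis
      using False y' by (auto simp: anchor_arcs_def arcs_iff)
  qed (simp add: anchor_arcs_def)
  then show ?thesis using between by (auto simp: q_def)
qed

text \<open>Orient each edge that is not bad so that the gap at \<open>w\<close> starts lower than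
  the gap at \<open>v\<close>, and send it to an anchor. The arcs sent to \<open>(v, y)\<close> have
  gaps stabbed by \<open>lab v y\<close>, so there are at most \<open>2 * k\<close> of them.\<close>

lemma card_arcs_le: "card arcs \<le> 64 * card V * (k + 1)\<^sup>2"
proof -
  let ?N = "card V"
  let ?A = "{(v, w) \<in> arcs - bad_arcs. pred2 w (lab v w) < pred2 v (lab v w)}"
  let ?fib = "\<lambda>(v, y). Pair v ` {w \<in> nbrs v. good w (lab v w) \<and> pred2 w (lab v w) \<le> lab v y \<and> lab v y < lab v w}"
  have finA: "finite ?A" using finite_arcs by (rule rev_finite_subset) auto
  have finH: "finite anchor_arcs"
    using finite_arcs by (rule rev_finite_subset) (auto simp: anchor_arcs_def bad_arcs_def)
  have fin_fib: "finite (?fib p)" for p using finite_nbrs by (auto split: prod.split)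
  have fib: "card (?fib p) \<le> 2 * k" for p
    by (cases p) (auto intro!: order.trans[OF card_image_le card_stabbed_le] simp: finite_nbrs)
  have "?A \<subseteq> (\<Union>p\<in>anchor_arcs. ?fib p)"
  proof
    fix p assume "p \<in> ?A"
    then obtain v w where p: "p = (v, w)" "adj v w" "good v (lab v w)" "good w (lab v w)"
      "pred2 w (lab v w) < pred2 v (lab v w)"
      by (auto simp: bad_arcs_def arcs_iff)
    obtain y where "(v, y) \<in> anchor_arcs" "pred2 w (lab v w) \<le> lab v y" "lab v y < lab v w"
      using anchor_exists[OF p(2-5)] by blast
    then show "p \<in> (\<Union>p\<in>anchor_arcs. ?fib p)"
      using p by (intro UN_I[of "(v, y)"]) (auto simp: nbrs_def)
  qed
  then have "card ?A \<le> card (\<Union>p\<in>anchor_arcs. ?fib p)"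
    by (rule card_mono[rotated]) (use finH fin_fib in auto)
  also have "\<dots> \<le> (\<Sum>p\<in>anchor_arcs. card (?fib p))" using finH by (rule card_UN_le)
  also have "\<dots> \<le> card anchor_arcs * (2 * k)"
    using sum_bounded_above[of anchor_arcs "\<lambda>p. card (?fib p)" "2 * k"] fib by simp
  also have "\<dots> \<le> (2 * (?N * (4 + 2 * k)) + ?N * (2 * k)) * (2 * k)"
    using card_anchor_arcs_le by (rule mult_right_mono) simp
  finally have A: "card ?A \<le> (2 * (?N * (4 + 2 * k)) + ?N * (2 * k)) * (2 * k)" .
  have "arcs \<subseteq> bad_arcs \<union> (?A \<union> prod.swap ` ?A)"
  proof
    fix p assume "p \<in> arcs"
    then obtain v w where p: "p = (v, w)" "adj v w" by (cases p) (auto simp: arcs_iff)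
    have "p \<in> ?A \<union> prod.swap ` ?A" if nb: "p \<notin> bad_arcs"
    proof -
      have g: "good v (lab v w)" "good w (lab v w)"
        using nb p by (auto simp: bad_arcs_def arcs_iff)
      then have l: "\<not> low v (lab v w)" "\<not> low w (lab v w)" by (auto simp: good_def)
      \<comment> \<open>A common value would have to be \<open>lab v w\<close> itself, but both
        values lie strictly below it.\<close>
      have "pred2 v (lab v w) \<noteq> pred2 w (lab v w)"
        using labs_common[OF p(2) not_low(3)[OF l(1)]] not_low(2,3)[OF l(2)] by auto
      then consider "pred2 w (lab v w) < pred2 v (lab v w)" | "pred2 v (lab v w) < pred2 w (lab v w)"
        by linarith
      then show ?thesis
      proof cases
        case 1
        then show ?thesis using p nb by (auto simp: arcs_iff)
      next
        case 2
        then have "(w, v) \<in> ?A"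
          using p g lab_sym[of v w] adj_sym by (auto simp: arcs_iff bad_arcs_def)
        then show ?thesis using p by force
      qed
    qed
    then show "p \<in> bad_arcs \<union> (?A \<union> prod.swap ` ?A)" by blast
  qed
  moreover have "finite bad_arcs" using finite_arcs by (rule rev_finite_subset) (auto simp: bad_arcs_def)
  ultimately have "card arcs \<le> card (bad_arcs \<union> (?A \<union> prod.swap ` ?A))"
    using finA by (intro card_mono) auto
  also have "\<dots> \<le> card bad_arcs + (card ?A + card (prod.swap ` ?A))"
    by (meson add_left_mono card_Un_le order.trans)
  also have "card (prod.swap ` ?A) \<le> card ?A" using finA by (rule card_image_le)
  finally have "card arcs \<le> card bad_arcs + (card ?A + card ?A)" by simp
  also have "\<dots> \<le> 2 * (?N * (4 + 2 * k)) + 2 * ((2 * (?N * (4 + 2 * k)) + ?N * (2 * k)) * (2 * k))"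
    using A card_bad_arcs_le by linarith
  also have "\<dots> = ?N * (8 + 36 * k + 24 * k\<^sup>2)"
    by (simp add: algebra_simps power2_eq_square)
  also have "\<dots> \<le> ?N * (64 * (k + 1)\<^sup>2)"
    by (intro mult_left_mono) (auto simp: algebra_simps power2_eq_square)
  finally show ?thesis by (simp add: algebra_simps)
qed

end

section \<open>From edge orders to integer labels\<close>

lemma linear_order_on_Int_Times:
  assumes "linear_order_on A r" "B \<subseteq> A"
  shows "linear_order_on B (r \<inter> B \<times> B)"
  using assms
  unfolding linear_order_on_def partial_order_on_def preorder_on_def refl_on_def trans_def
    antisym_def total_on_def
  by blast

lemma eo_contains_eo_pathI:
  fixes g :: "nat \<Rightarrow> 'a"
  assumes G: "edge_ordered_graph G"
    and inj: "inj_on g {0..length as}"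
    and vs: "\<And>i. i \<le> length as \<Longrightarrow> g i \<in> verts G"
    and es: "\<And>i. i < length as \<Longrightarrow> {g i, g (Suc i)} \<in> edges G"
    and ord: "\<And>i j. \<lbrakk>i < length as; j < length as\<rbrakk> \<Longrightarrow>
      ({g i, g (Suc i)}, {g j, g (Suc j)}) \<in> eord G \<longleftrightarrow> as ! i \<le> as ! j"
  shows "eo_contains G (eo_path as)"
proof -
  let ?I = "{0..length as}"
  define E where "E = {{g i, g (Suc i)} | i. i < length as}"
  define K where "K = \<lparr>verts = g ` ?I, edges = E, eord = eord G \<inter> E \<times> E\<rparr>"
  \<comment> \<open>An isomorphism leads from the subgraph to the path, so the witness is the
    inverse of the placement \<open>g\<close>.\<close>
  define f where "f = inv_into ?I g"
  have E_sub: "E \<subseteq> edges G" using es by (auto simp: E_def)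
  have K: "edge_ordered_graph K"
    unfolding edge_ordered_graph_def
  proof (intro conjI ballI)
    show "finite (verts K)" by (simp add: K_def)
    show "linear_order_on (edges K) (eord K)"
      using G E_sub by (auto simp: K_def edge_ordered_graph_def intro: linear_order_on_Int_Times)
  next
    fix e assume e: "e \<in> edges K"
    then show "e \<subseteq> verts K" by (auto simp: K_def E_def)
    show "card e = 2" using e E_sub G by (auto simp: K_def edge_ordered_graph_def)
  qed
  have "eo_subgraph K G"
    unfolding eo_subgraph_def using K G E_sub vs by (auto simp: K_def)
  moreover have "eo_isomorphism f K (eo_path as)"
    unfolding eo_isomorphism_def
  proof (intro conjI ballI)
    show "bij_betw f (verts K) (verts (eo_path as))"
      using bij_betw_inv_into[OF inj_on_imp_bij_betw[OF inj]]
      by (simp add: f_def K_def eo_path_def)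
  next
    fix u v assume "u \<in> verts K" "v \<in> verts K"
    then obtain a b where ab: "a \<in> ?I" "b \<in> ?I" "u = g a" "v = g b" by (auto simp: K_def)
    \<comment> \<open>Injectivity of \<open>g\<close> passes to pairs, so path vertices that are not
      consecutive span no edge of \<open>K\<close>, even if they do in \<open>G\<close>.\<close>
    have "{g a, g b} = {g i, g (Suc i)} \<longleftrightarrow> {a, b} = {i, Suc i}" if "i < length as" for i
      using inj_on_image_eq_iff[OF inj, of "{a, b}" "{i, Suc i}"] ab that by simp
    then show "{u, v} \<in> edges K \<longleftrightarrow> {f u, f v} \<in> edges (eo_path as)"
      using ab inj by (auto simp: f_def K_def E_def eo_path_def)
  next
    fix e e' assume "e \<in> edges K" "e' \<in> edges K"
    then obtain i j where ij: "i < length as" "j < length as"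
      "e = {g i, g (Suc i)}" "e' = {g j, g (Suc j)}" by (auto simp: K_def E_def)
    then have f: "f ` e = {i, Suc i}" "f ` e' = {j, Suc j}" using inj by (auto simp: f_def)
    have "(e, e') \<in> eord K \<longleftrightarrow> as ! i \<le> as ! j"
      using ij ord[of i j] by (auto simp: K_def E_def)
    moreover have "({i, Suc i}, {j, Suc j}) \<in> eord (eo_path as) \<longleftrightarrow> as ! i \<le> as ! j"
      using ij by (auto simp: eo_path_def edge_Suc_eq_iff)
    ultimately show "(e, e') \<in> eord K \<longleftrightarrow> (f ` e, f ` e') \<in> eord (eo_path as)"
      by (simp add: f)
  qed
  ultimately show ?thesis by (auto simp: eo_contains_def eo_isomorphic_def)
qed

text \<open>Label each edge by its rank in the order. There are at most \<open>2 ^ c * 2 ^ c\<close>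
  ordered pairs of vertices, so the ranks are below \<open>2 ^ (2 * c)\<close> and
  \<open>card_arcs_le\<close> applies with \<open>k = 2 * c\<close>.\<close>

lemma card_edges_le:
  fixes G :: "'a eo_graph"
  assumes G: "edge_ordered_graph G" and free: "\<not> eo_contains G (eo_path [1, 3, 4, 2])"
    and c: "card (verts G) \<le> 2 ^ c"
  shows "card (edges G) \<le> 64 * card (verts G) * (2 * c + 1)\<^sup>2"
proof -
  let ?V = "verts G" and ?E = "edges G" and ?r = "eord G"
  define rank where "rank e = card {e' \<in> ?E. (e', e) \<in> ?r \<and> e' \<noteq> e}" for e
  have finV: "finite ?V" and E: "\<And>e. e \<in> ?E \<Longrightarrow> e \<subseteq> ?V \<and> card e = 2"
    and lin: "linear_order_on ?E ?r"
    using G by (auto simp: edge_ordered_graph_def)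
  have finE: "finite ?E" by (rule finite_subset[of _ "Pow ?V"]) (use E finV in auto)
  have trans: "trans ?r" and antisym: "antisym ?r" and total: "total_on ?E ?r" and refl: "refl_on ?E ?r"
    using lin by (auto simp: linear_order_on_def partial_order_on_def preorder_on_def)
  have rank_less: "rank e < rank e'" if "e \<in> ?E" "e' \<in> ?E" "(e, e') \<in> ?r" "e \<noteq> e'" for e e'
    unfolding rank_def
  proof (rule psubset_card_mono)
    show "{d \<in> ?E. (d, e) \<in> ?r \<and> d \<noteq> e} \<subset> {d \<in> ?E. (d, e') \<in> ?r \<and> d \<noteq> e'}"
      using that transD[OF trans] antisymD[OF antisym] by blast
  qed (use finE in auto)
  have rank_le: "(e, e') \<in> ?r \<longleftrightarrow> rank e \<le> rank e'" if "e \<in> ?E" "e' \<in> ?E" for e e'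
  proof (cases "e = e'")
    case False
    then have "(e, e') \<in> ?r \<or> (e', e) \<in> ?r" using total that by (auto simp: total_on_def)
    then show ?thesis using rank_less[of e e'] rank_less[of e' e] that False by fastforce
  qed (use refl that in \<open>auto simp: refl_on_def\<close>)
  have rank_inj: "e = e'" if "e \<in> ?E" "e' \<in> ?E" "rank e = rank e'" for e e'
    using rank_le[of e e'] rank_le[of e' e] that antisymD[OF antisym] by auto
  define A where "A = {(x, y). {x, y} \<in> ?E}"
  have A_sub: "A \<subseteq> ?V \<times> ?V" using E by (auto simp: A_def)
  then have fin_A: "finite A" using finV by (auto intro: finite_subset)
  have "?E \<subseteq> (\<lambda>(x, y). {x, y}) ` A"
  proof
    fix e assume "e \<in> ?E"
    moreover from this E obtain x y where "e = {x, y}" by (metis card_2_iff)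
    ultimately show "e \<in> (\<lambda>(x, y). {x, y}) ` A" by (auto simp: A_def)
  qed
  then have E_le: "card ?E \<le> card A" using fin_A by (rule surj_card_le[rotated])
  also have "\<dots> \<le> card (?V \<times> ?V)" using A_sub finV by (intro card_mono) auto
  also have "\<dots> \<le> 2 ^ c * 2 ^ c" unfolding card_cartesian_product using c by (intro mult_mono) auto
  finally have E_pow: "card ?E \<le> 2 ^ (2 * c)" by (simp add: power_add[symmetric] mult_2)
  interpret labelled_P1342_free ?V "\<lambda>x y. {x, y} \<in> ?E" "\<lambda>x y. rank {x, y}" "2 * c"
  proof
    show "finite ?V" by (rule finV)
    show "x \<in> ?V" if "{x, y} \<in> ?E" for x y using E that by auto
    show "{y, x} \<in> ?E" if "{x, y} \<in> ?E" for x y using that by (simp add: insert_commute)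
    show "{x, x} \<notin> ?E" for x using E[of "{x, x}"] by auto
    show "rank {x, y} = rank {y, x}" for x y by (simp add: insert_commute)
    show "{x, y} = {u, v}" if "{x, y} \<in> ?E" "{u, v} \<in> ?E" "rank {x, y} = rank {u, v}" for x y u v
      using rank_inj that by blast
    show "rank {x, y} < 2 ^ (2 * c)" if "{x, y} \<in> ?E" for x y
    proof -
      have "rank {x, y} < card ?E"
        unfolding rank_def by (rule psubset_card_mono) (use finE that in auto)
      then show ?thesis using E_pow by simp
    qed
    show "\<not> distinct [v1, v2, v3, v4, v5]"
      if es: "{v1, v2} \<in> ?E" "{v2, v3} \<in> ?E" "{v3, v4} \<in> ?E" "{v4, v5} \<in> ?E"
        and lt: "rank {v1, v2} < rank {v4, v5}" "rank {v4, v5} < rank {v2, v3}"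
          "rank {v2, v3} < rank {v3, v4}"
      for v1 v2 v3 v4 v5
    proof
      assume dist: "distinct [v1, v2, v3, v4, v5]"
      let ?g = "\<lambda>i. [v1, v2, v3, v4, v5] ! i"
      have less4: "i = 0 \<or> i = 1 \<or> i = 2 \<or> i = 3" if "i < length [1, 3, 4, 2 :: nat]" for i
        using that by auto
      have in_E: "{?g i, ?g (Suc i)} \<in> ?E" if "i < length [1, 3, 4, 2 :: nat]" for i
        using less4[OF that] es by auto
      have "eo_contains G (eo_path [1, 3, 4, 2])"
      proof (rule eo_contains_eo_pathI[OF G, where g = ?g])
        show "inj_on ?g {0..length [1, 3, 4, 2 :: nat]}"
          using inj_on_nth[OF dist] by auto
        show "?g i \<in> ?V" if "i \<le> length [1, 3, 4, 2 :: nat]" for i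
        proof -
          have "set [v1, v2, v3, v4, v5] \<subseteq> ?V" using es E by auto
          then show ?thesis using that by (intro subsetD[OF _ nth_mem]) auto
        qed
        show "({?g i, ?g (Suc i)}, {?g j, ?g (Suc j)}) \<in> ?r \<longleftrightarrow> [1, 3, 4, 2] ! i \<le> [1, 3, 4, 2 :: nat] ! j"
          if "i < length [1, 3, 4, 2 :: nat]" "j < length [1, 3, 4, 2 :: nat]" for i j
          unfolding rank_le[OF in_E[OF that(1)] in_E[OF that(2)]]
          using less4[OF that(1)] less4[OF that(2)] lt by (elim disjE) simp_all
      qed (rule in_E)
      then show False using free by simp
    qed
  qed
  have "arcs = A" by (auto simp: arcs_iff A_def)
  then show ?thesis using E_le card_arcs_le by simp
qed

theorem theorem4p16:
  shows "(\<lambda>n. real (ex_eo n (eo_path [1, 3, 4, 2]))) \<in> O(\<lambda>n. real n * (ln (real n))\<^sup>2)"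
proof (rule bigoI[where c = "64 * (7 / ln 2)\<^sup>2"])
  let ?H = "eo_path [1, 3, 4, 2]"
  show "\<forall>\<^sub>F n in sequentially. norm (real (ex_eo n ?H))
      \<le> 64 * (7 / ln 2)\<^sup>2 * norm (real n * (ln (real n))\<^sup>2)"
  proof (rule eventually_sequentiallyI[of 2])
    fix n :: nat assume n: "2 \<le> n"
    define c where "c = nat \<lceil>log 2 (real n)\<rceil>"
    have log_ge: "1 \<le> log 2 (real n)" using n by (simp add: le_log_iff)
    then have c_ge: "log 2 (real n) \<le> real c" and c_le: "real c \<le> log 2 (real n) + 1"
      unfolding c_def by linarith+
    have "real n \<le> 2 powr real c" using n c_ge by (simp add: log_le_iff)
    then have n_le: "n \<le> 2 ^ c" by (simp add: powr_realpow flip: of_nat_le_iff)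
    have H: "edge_ordered_graph ?H" "edges ?H \<noteq> {}"
      by (rule edge_ordered_graph_eo_path) (auto simp: eo_path_def)
    obtain G :: "nat eo_graph" where G: "ex_eo n ?H = card (edges G)" "edge_ordered_graph G"
      "card (verts G) = n" "\<not> eo_contains G ?H"
      using Max_in[OF ex_eo_set_finite_nonempty[OF H, of n]] unfolding ex_eo_def by auto
    have "ex_eo n ?H \<le> 64 * n * (2 * c + 1)\<^sup>2"
      using card_edges_le[OF G(2,4), of c] G n_le by simp
    then have "real (ex_eo n ?H) \<le> real (64 * n * (2 * c + 1)\<^sup>2)"
      by (simp only: of_nat_le_iff)
    also have "\<dots> = 64 * real n * (2 * real c + 1)\<^sup>2" by simp
    \<comment> \<open>As the logarithm is at least 1, it absorbs the constants:
      \<open>2 * c + 1\<close> is at most \<open>2 * log 2 n + 3\<close>, hence at most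
      \<open>7 * log 2 n\<close>.\<close>
    also have "\<dots> \<le> 64 * real n * (7 * log 2 (real n))\<^sup>2"
      using c_le log_ge by (intro mult_left_mono power_mono) auto
    also have "\<dots> = 64 * (7 / ln 2)\<^sup>2 * norm (real n * (ln (real n))\<^sup>2)"
      by (simp add: log_def power_divide power_mult_distrib abs_mult)
    finally show "norm (real (ex_eo n ?H)) \<le> 64 * (7 / ln 2)\<^sup>2 * norm (real n * (ln (real n))\<^sup>2)"
      by simp
  qed
qed

end
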